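(* Let $m>n$ be positive integers. There is a map $\Phi:\mathcal{D}_{m,n}\to\mathcal{D}_{m,n}$ such that for every $P\in\mathcal{D}_{m,n}$: $\Phi(\Phi(P))=P$, $\mathrm{comp}(\Phi(P))=\mathrm{comp}(P)$, $\mathrm{run}(\Phi(P))=\mathrm{ret}(P)$ and $\mathrm{ret}(\Phi(P))=\mathrm{run}(P)$.
   Context: An $m\times n$ rational Dyck path is a lattice path from $(0,0)$ to $(m,n)$ using unit north steps $N=(0,1)$ and east steps $E=(1,0)$ that stays weakly above the line $y=nx/m$; $\mathcal{D}_{m,n}$ denotes the set of these paths. For $P\in\mathcal{D}_{m,n}$, its coarea sequence is $(u_1,\dots,u_n)$, where $u_i$ is the $x$-coordinate of the $i$-th north step of $P$ (counted from bottom to top), i.e. the number of cells of the $m\times n$ rectangle to the left of that step. The run statistic is $\mathrm{run}(P)=\min\{i\in\{1,\dots,n\}: i\notin\{u_1,\dots,u_n\}\}$. The rank of a lattice point $(i,j)$ is $jm-in$. The return statistic $\mathrm{ret}(P)$ is the number of north steps of $P$ from some $(i,j)$ to $(i,j+1)$ with $jm-in<n$ (equivalently, the number of north steps lying on the boundary of a cell of the rectangle whose interior meets the line $y=nx/m$). The composition type $\mathrm{comp}(P)$ is the composition of $n$ formed by the lengths of the maximal blocks of consecutive north steps of $P$, read from start to end. *)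

theory Defs
  imports Complex_Main "HOL-Library.FuncSet"
begin

datatype step = North | East

type_synonym path = "step list"

text \<open>End point, as a pair \<open>(x, y)\<close>, of a path starting at the origin; \<open>endpoint (take k P)\<close> is
  the lattice point reached by \<open>P\<close> after \<open>k\<close> steps.\<close>

definition endpoint :: "path \<Rightarrow> nat \<times> nat" where
  "endpoint P = (count_list P East, count_list P North)"

text \<open>Half-planes are convex, so a path stays weakly above the line \<open>y = n x / m\<close> iff every lattice
  point it visits does.\<close>

definition weakly_above :: "nat \<Rightarrow> nat \<Rightarrow> nat \<times> nat \<Rightarrow> bool" where
  "weakly_above m n = (\<lambda>(x, y). real y \<ge> real n * real x / real m)"

definition Dyck :: "nat \<Rightarrow> nat \<Rightarrow> path set" where
  "Dyck m n = {P. endpoint P = (m, n) \<and> (\<forall>k\<le>length P. weakly_above m n (endpoint (take k P)))}"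

text \<open>Starting points of the north steps, from bottom to top.\<close>

definition north_starts :: "path \<Rightarrow> (nat \<times> nat) list" where
  "north_starts P =
     map (\<lambda>k. endpoint (take k P)) (filter (\<lambda>k. P ! k = North) [0..<length P])"

definition coarea :: "path \<Rightarrow> nat list" where
  "coarea P = map fst (north_starts P)"

text \<open>For \<open>P \<in> Dyck m n\<close> with \<open>n > 0\<close> the set below is nonempty: the coarea sequence has \<open>n\<close>
  entries, the first of which is \<open>0\<close>.\<close>

definition run :: "nat \<Rightarrow> path \<Rightarrow> nat" where
  "run n P = Min {i \<in> {1..n}. i \<notin> set (coarea P)}"

definition rank :: "nat \<Rightarrow> nat \<Rightarrow> nat \<times> nat \<Rightarrow> int" where
  "rank m n = (\<lambda>(i, j). int j * int m - int i * int n)"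

definition ret :: "nat \<Rightarrow> nat \<Rightarrow> path \<Rightarrow> nat" where
  "ret m n P = length (filter (\<lambda>p. rank m n p < int n) (north_starts P))"

text \<open>Lengths of the maximal blocks of consecutive north steps.\<close>

function comp_type :: "path \<Rightarrow> nat list" where
  "comp_type [] = []"
| "comp_type (East # P) = comp_type P"
| "comp_type (North # P) =
     length (takeWhile (\<lambda>s. s = North) (North # P)) # comp_type (dropWhile (\<lambda>s. s = North) P)"
  by pat_completeness auto
termination
  by (relation "measure length") (auto simp: le_imp_less_Suc length_dropWhile_le)

end

theory Submission imports Defs begin

text \<open>Fix the composition type. A path is then the strictly increasing list of the abscissae of its
  north blocks, bounded entrywise by a strictly increasing list \<open>B\<close> that depends only on the
  composition type; \<open>run\<close> counts the leading entries that are as small as possible and, since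
  \<open>n < m\<close>, \<open>ret\<close> counts the entries that meet their bound. Write \<open>M a B i j\<close> for the number of
  such lists with entries at least \<open>a\<close>, \<open>i\<close> leading minimal entries and \<open>j\<close> maximal entries. By
  induction \<open>M a B\<close> is symmetric in \<open>i\<close> and \<open>j\<close>, and even depends only on \<open>i + j\<close> if all bounds
  exceed \<open>a\<close>: for \<open>i > 0\<close> remove the first entry, which is \<open>a\<close>, and for \<open>i = 0\<close> raise \<open>a\<close>. Fibres
  of \<open>(comp, run, ret)\<close> that are exchanged by swapping the last two statistics thus have the
  same size.\<close>

section \<open>Bounded increasing lists\<close>

text \<open>Strict increase is carried by the lower bound, which becomes \<open>Suc v\<close> after
  an entry \<open>v\<close>; this leaves \<open>a\<close> free to vary in the inductions.\<close>

fun bounded_inc :: "nat \<Rightarrow> nat list \<Rightarrow> nat list \<Rightarrow> bool" where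
  "bounded_inc a [] [] \<longleftrightarrow> True"
| "bounded_inc a (b # B) (v # vs) \<longleftrightarrow> a \<le> v \<and> v \<le> b \<and> bounded_inc (Suc v) B vs"
| "bounded_inc a _ _ \<longleftrightarrow> False"

fun lead_min :: "nat \<Rightarrow> nat list \<Rightarrow> nat" where
  "lead_min a [] = 0"
| "lead_min a (v # vs) = (if v = a then Suc (lead_min (Suc a) vs) else 0)"

fun num_max :: "nat list \<Rightarrow> nat list \<Rightarrow> nat" where
  "num_max (b # B) (v # vs) = of_bool (v = b) + num_max B vs"
| "num_max _ _ = 0"

definition inc_set :: "nat \<Rightarrow> nat list \<Rightarrow> nat \<Rightarrow> nat \<Rightarrow> nat list set" where
  "inc_set a B i j = {vs. bounded_inc a B vs \<and> lead_min a vs = i \<and> num_max B vs = j}"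

lemma bounded_inc_Nil_iff [simp]: "bounded_inc a [] vs \<longleftrightarrow> vs = []"
  by (cases vs) auto

lemma bounded_inc_Cons_iff:
  "bounded_inc a (b # B) vs \<longleftrightarrow> (\<exists>v ws. vs = v # ws \<and> a \<le> v \<and> v \<le> b \<and> bounded_inc (Suc v) B ws)"
  by (cases vs) auto

lemma bounded_inc_antimono: "bounded_inc a B vs \<Longrightarrow> a' \<le> a \<Longrightarrow> bounded_inc a' B vs"
  by (cases B) (auto simp: bounded_inc_Cons_iff)

lemma bounded_inc_length: "bounded_inc a B vs \<Longrightarrow> length vs = length B"
  by (induction a B vs rule: bounded_inc.induct) auto

lemma bounded_inc_ge: "bounded_inc a B vs \<Longrightarrow> v \<in> set vs \<Longrightarrow> a \<le> v"
  by (induction a B vs rule: bounded_inc.induct) auto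

lemma bounded_inc_sorted: "bounded_inc a B vs \<Longrightarrow> sorted_wrt (<) vs"
proof (induction a B vs rule: bounded_inc.induct)
  case (2 a b B v vs)
  then show ?case using bounded_inc_ge[of "Suc v" B vs] by (auto simp: Suc_le_eq)
qed auto

lemma finite_bounded_inc: "finite {vs. bounded_inc a B vs}"
proof (induction B arbitrary: a)
  case Nil
  have "{vs. bounded_inc a [] vs} = {[]}" by auto
  then show ?case by simp
next
  case (Cons b B)
  have "{vs. bounded_inc a (b # B) vs} \<subseteq> (\<Union>v\<le>b. (#) v ` {vs. bounded_inc (Suc v) B vs})"
    by (auto simp: bounded_inc_Cons_iff)
  then show ?case using Cons by (meson finite_UN_I finite_atMost finite_imageI finite_subset)
qed

lemma finite_inc_set: "finite (inc_set a B i j)"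
  unfolding inc_set_def by (rule finite_subset[OF _ finite_bounded_inc[of a B]]) auto

lemma lead_min_le: "lead_min a vs \<le> length vs"
  by (induction a vs rule: lead_min.induct) auto

lemma num_max_le: "num_max B vs \<le> length vs"
  by (induction B vs rule: num_max.induct) auto

lemma lead_min_mem: "a \<le> k \<Longrightarrow> k < a + lead_min a vs \<Longrightarrow> k \<in> set vs"
proof (induction a vs rule: lead_min.induct)
  case (2 a v vs)
  then show ?case by (cases "k = a") (auto split: if_splits)
qed simp

lemma lead_min_notin: "bounded_inc a B vs \<Longrightarrow> a + lead_min a vs \<notin> set vs"
proof (induction a B vs rule: bounded_inc.induct)
  case (2 a b B v vs)
  have "k \<notin> set vs" if "k \<le> v" for k
    using that 2 bounded_inc_ge[of "Suc v" B vs k] by auto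
  then show ?case using 2 by auto
qed auto

text \<open>The leading entries cover all values below \<open>lead_min 0 vs\<close>, and that value
  itself is missed. Its positivity and the length bound place it in \<open>{1..n}\<close>.\<close>

lemma lead_min_eq_Min:
  assumes "bounded_inc 0 B vs" and "0 < lead_min 0 vs" and "length vs \<le> n"
  shows "Min {i \<in> {1..n}. i \<notin> set vs} = lead_min 0 vs"
proof (rule Min_eqI)
  show "lead_min 0 vs \<in> {i \<in> {1..n}. i \<notin> set vs}"
    using assms lead_min_notin[OF assms(1)] lead_min_le[of 0 vs] by auto
  show "lead_min 0 vs \<le> i" if "i \<in> {i \<in> {1..n}. i \<notin> set vs}" for i
    using that lead_min_mem[of 0 i vs] by (auto simp: not_less[symmetric])
qed simp

section \<open>Recursions for the numbers of bounded lists\<close>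

lemma card_inc_set_Suc:
  assumes "a < b"
  shows "card (inc_set a (b # B) (Suc i) j) = card (inc_set (Suc a) B i j)"
proof -
  have "inc_set a (b # B) (Suc i) j = (#) a ` inc_set (Suc a) B i j"
    using assms by (auto simp: inc_set_def bounded_inc_Cons_iff split: if_splits)
  then show ?thesis by (simp add: card_image)
qed

text \<open>When the first bound is \<open>a\<close>, the first entry is forced and is both minimal
  and maximal, so its removal lowers both statistics; for \<open>a < b\<close> only the first
  statistic drops.\<close>

lemma card_inc_set_tight:
  "card (inc_set a (a # B) (Suc i) (Suc j)) = card (inc_set (Suc a) B i j)"
proof -
  have "inc_set a (a # B) (Suc i) (Suc j) = (#) a ` inc_set (Suc a) B i j"
    by (auto simp: inc_set_def bounded_inc_Cons_iff split: if_splits)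
  then show ?thesis by (simp add: card_image)
qed

lemma inc_set_tight_empty: "i = 0 \<or> j = 0 \<Longrightarrow> inc_set a (a # B) i j = {}"
  by (auto simp: inc_set_def bounded_inc_Cons_iff)

text \<open>\<open>min_set\<close> and \<open>max_set\<close> are the two marginals of the joint
  count; wherever that count is symmetric, they have equal size.\<close>

definition min_set :: "nat \<Rightarrow> nat list \<Rightarrow> nat \<Rightarrow> nat list set" where
  "min_set a B i = {vs. bounded_inc a B vs \<and> lead_min a vs = i}"

definition max_set :: "nat \<Rightarrow> nat list \<Rightarrow> nat \<Rightarrow> nat list set" where
  "max_set a B j = {vs. bounded_inc a B vs \<and> num_max B vs = j}"

lemma card_min_set: "card (min_set a B i) = (\<Sum>j\<le>length B. card (inc_set a B i j))"
proof -
  have "min_set a B i = (\<Union>j\<le>length B. inc_set a B i j)"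
    using num_max_le[of B] bounded_inc_length[of a B]
    by (auto simp: min_set_def inc_set_def) metis
  then show ?thesis
    by (simp only:) (rule card_UN_disjoint, auto simp: finite_inc_set, auto simp: inc_set_def)
qed

lemma card_max_set: "card (max_set a B j) = (\<Sum>i\<le>length B. card (inc_set a B i j))"
proof -
  have "max_set a B j = (\<Union>i\<le>length B. inc_set a B i j)"
    using lead_min_le[of a] bounded_inc_length[of a B]
    by (auto simp: max_set_def inc_set_def) metis
  then show ?thesis
    by (simp only:) (rule card_UN_disjoint, auto simp: finite_inc_set, auto simp: inc_set_def)
qed

lemma card_min_set_Suc:
  assumes "a \<le> b"
  shows "card (min_set a (b # B) (Suc i)) = card (min_set (Suc a) B i)"
proof -
  have "min_set a (b # B) (Suc i) = (#) a ` min_set (Suc a) B i"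
    using assms by (auto simp: min_set_def bounded_inc_Cons_iff split: if_splits)
  then show ?thesis by (simp add: card_image)
qed

text \<open>Without a leading minimal entry all entries exceed \<open>a\<close>, and relative to
  \<open>Suc a\<close> the leading entries are unrestricted. This turns a joint count into a
  marginal.\<close>

lemma inc_set_0: "inc_set a B 0 j = max_set (Suc a) B j"
  by (cases B) (auto simp: inc_set_def max_set_def bounded_inc_Cons_iff split: if_splits)

text \<open>The two claims feed each other: the shift at \<open>i = 0\<close> comes from symmetry of
  smaller instances, and symmetry for \<open>a < b\<close> comes from the shift. The measure drops
  when the first entry is removed and when \<open>a\<close> is raised while below all
  bounds.\<close>

lemma inc_set_sym_shift:
  assumes "sorted_wrt (<) B" and "\<forall>b\<in>set B. a \<le> b"
  shows "(\<forall>i j. card (inc_set a B i j) = card (inc_set a B j i)) \<and>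
    ((\<forall>b\<in>set B. a < b) \<longrightarrow> B \<noteq> [] \<longrightarrow>
      (\<forall>i j. card (inc_set a B (Suc i) j) = card (inc_set a B i (Suc j))))"
  using assms
proof (induction "length B + sum_list (map (\<lambda>b. b - a) B)" arbitrary: a B rule: less_induct)
  case less
  show ?case
  proof (cases B)
    case Nil
    have "inc_set a [] i j = (if i = 0 \<and> j = 0 then {[]} else {})" for i j
      by (auto simp: inc_set_def)
    then show ?thesis using Nil by auto
  next
    case (Cons b B')
    have decr: "sum_list (map (\<lambda>b. b - a') B') \<le> sum_list (map (\<lambda>b. b - a) B')" if "a \<le> a'" for a'
      using that by (intro sum_list_mono) auto
    have gt: "\<forall>x\<in>set B'. b < x" and sorted: "sorted_wrt (<) B'" using less.prems Cons by auto
    have ab: "a \<le> b" using less.prems Cons by auto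
    have tail: "(\<forall>i j. card (inc_set a' B' i j) = card (inc_set a' B' j i)) \<and>
        ((\<forall>b\<in>set B'. a' < b) \<longrightarrow> B' \<noteq> [] \<longrightarrow>
        (\<forall>i j. card (inc_set a' B' (Suc i) j) = card (inc_set a' B' i (Suc j))))"
      if "a \<le> a'" "a' \<le> Suc b" for a'
      by (rule less.hyps) (use decr[of a'] that gt sorted Cons in \<open>auto simp: Suc_le_eq\<close>)
    show ?thesis
    proof (cases "a = b")
      case True
      \<comment> \<open>The shift claim is vacuous here, as \<open>b\<close> does not exceed
        \<open>a\<close>; symmetry is inherited from \<open>B'\<close> with lower bound
        \<open>Suc a\<close>.\<close>
      have "card (inc_set a B i j) = card (inc_set a B j i)" for i j
        using tail[of "Suc a"] True
        by (cases i; cases j) (simp_all add: Cons card_inc_set_tight inc_set_tight_empty)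
      then show ?thesis using True Cons by auto
    next
      case False
      then have "a < b" using ab by simp
      have sym1: "card (inc_set (Suc a) B i j) = card (inc_set (Suc a) B j i)" for i j
        using less.hyps[of B "Suc a"] decr[of "Suc a"] \<open>a < b\<close> gt sorted Cons by fastforce
      have swap: "card (max_set a' C j) = card (min_set a' C j)"
        if "\<And>i j. card (inc_set a' C i j) = card (inc_set a' C j i)" for a' C j
        by (simp add: card_max_set card_min_set that[of _ j])
      \<comment> \<open>Raise \<open>a\<close>, pass to the other marginal by symmetry, remove the
        entry \<open>Suc a\<close>, and pass back by symmetry. Removing \<open>a\<close> from a list
        with exactly one leading minimal entry leads to the same marginal.\<close>
      have base: "card (inc_set a B 1 j) = card (inc_set a B 0 (Suc j))" for j
      proof -
        have "card (inc_set a B 0 (Suc j)) = card (min_set (Suc a) B (Suc j))"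
          using swap[OF sym1] by (simp add: inc_set_0)
        also have "\<dots> = card (min_set (Suc (Suc a)) B' j)"
          using \<open>a < b\<close> by (simp add: Cons card_min_set_Suc)
        also have "\<dots> = card (max_set (Suc (Suc a)) B' j)"
          using swap[of "Suc (Suc a)" B'] tail[of "Suc (Suc a)"] \<open>a < b\<close> by simp
        also have "\<dots> = card (inc_set a B 1 j)"
          using card_inc_set_Suc[OF \<open>a < b\<close>, of B' 0 j] by (simp add: inc_set_0 Cons)
        finally show ?thesis by simp
      qed
      have shift: "card (inc_set a B (Suc i) j) = card (inc_set a B i (Suc j))" for i j
      proof (cases i)
        case 0
        then show ?thesis using base by simp
      next
        \<comment> \<open>Removing the entry \<open>a\<close> reduces to the shift for
          \<open>B'\<close> at \<open>Suc a\<close>, where all bounds exceed \<open>b\<close> and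
          hence \<open>Suc a\<close>. If \<open>B'\<close> is empty, both sides are zero.\<close>
        case (Suc i')
        show ?thesis
        proof (cases "B' = []")
          case True
          then show ?thesis using Suc \<open>a < b\<close>
            by (simp add: Cons card_inc_set_Suc) (simp add: inc_set_def)
        next
          case False
          then show ?thesis using Suc \<open>a < b\<close> tail[of "Suc a"] gt
            by (simp add: Cons card_inc_set_Suc) fastforce
        qed
      qed
      \<comment> \<open>Iterating the shift moves all of \<open>i\<close> into the second index, so
        the count depends only on \<open>i + j\<close>.\<close>
      have "card (inc_set a B i j) = card (inc_set a B 0 (i + j))" for i j
        by (induction i arbitrary: j) (simp_all add: shift)
      then have "card (inc_set a B i j) = card (inc_set a B j i)" for i j
        by (metis add.commute)
      then show ?thesis using shift by blast
    qed
  qed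
qed

lemmas card_inc_set_sym = inc_set_sym_shift[THEN conjunct1, rule_format]

section \<open>Paths of a given composition type\<close>

text \<open>The entries of \<open>vs\<close> are absolute abscissae, hence the differences
  \<open>v - x\<close>; the constraints on the lists keep these truncated subtractions
  genuine.\<close>

fun path_of :: "nat \<Rightarrow> nat \<Rightarrow> nat list \<Rightarrow> nat list \<Rightarrow> path" where
  "path_of m x (c # cs) (v # vs) =
     replicate (v - x) East @ replicate c North @ path_of m v cs vs"
| "path_of m x _ _ = replicate (m - x) East"

text \<open>Here \<open>y\<close> is the height at which the next block starts; at that height the
  points weakly above the line are those with abscissa at most the floor of
  \<open>m * y / n\<close>. The later steps of a block only move away from the line.\<close>

fun bounds :: "nat \<Rightarrow> nat \<Rightarrow> nat \<Rightarrow> nat list \<Rightarrow> nat list" where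
  "bounds m n y [] = []"
| "bounds m n y (c # cs) = (m * y) div n # bounds m n (y + c) cs"

text \<open>The line condition cleared of denominators, with a free starting point so that blocks
  can be peeled off.\<close>

fun above :: "nat \<Rightarrow> nat \<Rightarrow> nat \<Rightarrow> nat \<Rightarrow> path \<Rightarrow> bool" where
  "above m n x y [] \<longleftrightarrow> n * x \<le> m * y"
| "above m n x y (North # P) \<longleftrightarrow> n * x \<le> m * y \<and> above m n x (Suc y) P"
| "above m n x y (East # P) \<longleftrightarrow> n * x \<le> m * y \<and> above m n (Suc x) y P"

fun starts :: "nat \<Rightarrow> nat \<Rightarrow> path \<Rightarrow> (nat \<times> nat) list" where
  "starts x y [] = []"
| "starts x y (North # P) = (x, y) # starts x (Suc y) P"
| "starts x y (East # P) = starts (Suc x) y P"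

section \<open>Recursive forms of the path conditions\<close>

lemma above_iff:
  "above m n x y P \<longleftrightarrow> (\<forall>k\<le>length P.
     n * (x + count_list (take k P) East) \<le> m * (y + count_list (take k P) North))"
proof (induction m n x y P rule: above.induct)
  case (2 m n x y P)
  show ?case by (simp add: 2 less_Suc_eq_le[symmetric] All_less_Suc2)
next
  case (3 m n x y P)
  show ?case by (simp add: 3 less_Suc_eq_le[symmetric] All_less_Suc2)
qed simp

lemma weakly_above_iff:
  assumes "0 < m"
  shows "weakly_above m n (x, y) \<longleftrightarrow> n * x \<le> m * y"
proof -
  have "weakly_above m n (x, y) \<longleftrightarrow> real (n * x) \<le> real (m * y)"
    using assms by (simp add: weakly_above_def divide_le_eq mult.commute)
  then show ?thesis by (simp only: of_nat_le_iff)
qed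

lemma Dyck_iff:
  assumes "0 < m"
  shows "P \<in> Dyck m n \<longleftrightarrow>
    count_list P East = m \<and> count_list P North = n \<and> above m n 0 0 P"
  by (simp add: Dyck_def above_iff endpoint_def weakly_above_iff[OF assms])

lemma starts_eq:
  "starts x y P = map (\<lambda>k. (x + count_list (take k P) East, y + count_list (take k P) North))
     (filter (\<lambda>k. P ! k = North) [0..<length P])"
  by (induction x y P rule: starts.induct)
    (simp_all add: upt_conv_Cons map_Suc_upt[symmetric] filter_map o_def del: upt_Suc)

lemma north_starts_eq: "north_starts P = starts 0 0 P"
  by (simp add: starts_eq north_starts_def endpoint_def)

lemma above_start: "above m n x y P \<Longrightarrow> n * x \<le> m * y"
  by (cases P; cases "hd P") auto

text \<open>Among the points of a run of east steps the last one is critical; for north steps it is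
  the first one.\<close>

lemma above_replicate_East: "above m n x y (replicate k East @ P) \<longleftrightarrow> above m n (x + k) y P"
proof (induction k arbitrary: x)
  case (Suc k)
  have "n * x \<le> m * y" if "above m n (Suc (x + k)) y P"
    using above_start[OF that] by (simp add: algebra_simps)
  then show ?case by (auto simp: Suc)
qed simp

lemma above_replicate_North:
  "above m n x y (replicate k North @ P) \<longleftrightarrow> n * x \<le> m * y \<and> above m n x (y + k) P"
proof (induction k arbitrary: y)
  case 0
  then show ?case using above_start by auto
next
  case (Suc k)
  show ?case by (auto simp: Suc)
qed

lemma starts_replicate_East: "starts x y (replicate k East @ P) = starts (x + k) y P"
  by (induction k arbitrary: x) simp_all

lemma starts_replicate_North:
  "starts x y (replicate k North @ P) = map (Pair x) [y..<y + k] @ starts x (y + k) P"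
  by (induction k arbitrary: y) (simp_all add: upt_conv_Cons del: upt_Suc)

lemma count_list_replicate: "count_list (replicate k a) b = (if a = b then k else 0)"
  by (induction k) auto

lemma comp_type_replicate_East: "comp_type (replicate k East @ P) = comp_type P"
  by (induction k) simp_all

text \<open>The condition on \<open>P\<close> makes the block maximal.\<close>

lemma comp_type_replicate_North:
  assumes "0 < k" and "P = [] \<or> hd P = East"
  shows "comp_type (replicate k North @ P) = k # comp_type P"
proof -
  obtain l where l: "k = Suc l" using assms by (cases k) auto
  have "takeWhile (\<lambda>s. s = North) (replicate l North @ P) = replicate l North"
    "dropWhile (\<lambda>s. s = North) (replicate l North @ P) = P"
    using assms(2) by (cases P; simp add: takeWhile_append dropWhile_append)+
  then show ?thesis by (simp add: l)
qed

lemma comp_type_pos: "c \<in> set (comp_type P) \<Longrightarrow> 0 < c"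
  by (induction P rule: comp_type.induct) auto

lemma north_block:
  obtains k Q where "North # P = replicate k North @ Q" "0 < k"
    "Q = dropWhile (\<lambda>s. s = North) P" "Q = [] \<or> hd Q = East"
proof -
  let ?Q = "dropWhile (\<lambda>s. s = North) P"
  have "takeWhile (\<lambda>s. s = North) P = replicate (length (takeWhile (\<lambda>s. s = North) P)) North"
    by (metis (mono_tags, lifting) replicate_eqI set_takeWhileD)
  then have "North # P = replicate (Suc (length (takeWhile (\<lambda>s. s = North) P))) North @ ?Q"
    by (metis append_Cons replicate_Suc takeWhile_dropWhile_id)
  moreover have "?Q = [] \<or> hd ?Q = East"
    using hd_dropWhile[of "\<lambda>s. s = North" P] by (cases "hd ?Q") auto
  ultimately show ?thesis using that by blast
qed

lemma sum_list_comp_type: "sum_list (comp_type P) = count_list P North"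
proof (induction P rule: comp_type.induct)
  case (3 P)
  obtain k Q where kQ: "North # P = replicate k North @ Q" "0 < k"
    "Q = dropWhile (\<lambda>s. s = North) P" "Q = [] \<or> hd Q = East"
    by (rule north_block)
  show ?case
    using 3 kQ(3) unfolding kQ(1) comp_type_replicate_North[OF kQ(2,4)]
    by (simp add: count_list_replicate)
qed simp_all

text \<open>A path that does not start with a north step can have its next block only strictly to
  the right of \<open>x\<close>. The remainder after a maximal north block is such a path, so the
  block abscissae come out strictly increasing.\<close>

lemma path_of_exists:
  assumes "0 < n" and "x + count_list P East = m" and "above m n x y P"
  shows "\<exists>vs. P = path_of m x (comp_type P) vs \<and>
    bounded_inc (if P = [] \<or> hd P = East then Suc x else x) (bounds m n y (comp_type P)) vs"
  using assms
proof (induction P arbitrary: x y rule: comp_type.induct)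
  case 1
  then show ?case by simp
next
  case (2 P)
  then obtain vs where vs: "P = path_of m (Suc x) (comp_type P) vs"
    "bounded_inc (if P = [] \<or> hd P = East then Suc (Suc x) else Suc x)
      (bounds m n y (comp_type P)) vs"
    by fastforce
  have b: "bounded_inc (Suc x) (bounds m n y (comp_type P)) vs"
    using vs(2) by (rule bounded_inc_antimono) simp
  \<comment> \<open>A first entry of at least \<open>Suc x\<close>, or \<open>x < m\<close> when no
    block is left, makes the path from \<open>x\<close> begin with an east step.\<close>
  have "path_of m x (comp_type P) vs = East # path_of m (Suc x) (comp_type P) vs"
  proof (cases "comp_type P")
    case Nil
    have "x < m" using 2(3) by auto
    then have "m - x = Suc (m - Suc x)" by simp
    then show ?thesis by (simp only: Nil path_of.simps replicate_Suc)
  next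
    case (Cons c cs)
    then obtain v ws where v: "vs = v # ws" "Suc x \<le> v"
      using b by (auto simp: bounded_inc_Cons_iff)
    then have "v - x = Suc (v - Suc x)" by simp
    then show ?thesis by (simp only: Cons v(1) path_of.simps replicate_Suc append_Cons)
  qed
  with vs(1) have "path_of m x (comp_type P) vs = East # P" by metis
  then show ?case using b by (intro exI[of _ vs]) simp
next
  case (3 P)
  obtain k Q where kQ: "North # P = replicate k North @ Q" "0 < k"
    "Q = dropWhile (\<lambda>s. s = North) P" "Q = [] \<or> hd Q = East"
    by (rule north_block)
  have c: "comp_type (North # P) = k # comp_type Q"
    unfolding kQ(1) by (rule comp_type_replicate_North[OF kQ(2,4)])
  have ab: "n * x \<le> m * y" "above m n x (y + k) Q"
    using 3(4) unfolding kQ(1) above_replicate_North by auto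
  have "x + count_list Q East = m"
    using 3(3) unfolding kQ(1) by (simp add: count_list_replicate)
  then obtain vs where vs: "Q = path_of m x (comp_type Q) vs"
    "bounded_inc (Suc x) (bounds m n (y + k) (comp_type Q)) vs"
    using 3(1)[of x "y + k"] \<open>0 < n\<close> ab kQ(3,4) by auto
  have "x \<le> m * y div n" using ab \<open>0 < n\<close> by (simp add: less_eq_div_iff_mult_less_eq mult.commute)
  moreover have "path_of m x (comp_type (North # P)) (x # vs) = North # P"
    unfolding c using vs(1)[symmetric] kQ(1) by simp
  ultimately show ?case
    using vs(2) by (intro exI[of _ "x # vs"]) (simp add: c del: comp_type.simps)
qed

section \<open>From lists back to paths\<close>

lemma hd_path_of:
  assumes "bounded_inc (Suc x) (bounds m n y cs) vs"
  shows "path_of m x cs vs = [] \<or> hd (path_of m x cs vs) = East"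
proof (cases cs)
  case Nil
  then show ?thesis by (cases "m - x") auto
next
  case (Cons c cs')
  then obtain v ws where v: "vs = v # ws" "Suc x \<le> v"
    using assms by (auto simp: bounded_inc_Cons_iff)
  then have "v - x = Suc (v - Suc x)" by simp
  then show ?thesis using Cons v by (simp only: path_of.simps replicate_Suc) simp
qed

lemma bounded_inc_bounds_Cons:
  assumes "bounded_inc x (bounds m n y (c # cs)) vs"
  obtains v ws where "vs = v # ws" "x \<le> v" "v \<le> m * y div n"
    "bounded_inc (Suc v) (bounds m n (y + c) cs) ws"
  using assms by (auto simp: bounded_inc_Cons_iff)

text \<open>Strict increase puts an east step between consecutive blocks and positive lengths keep
  the blocks nonempty, so none of them merge or vanish.\<close>

lemma comp_type_path_of:
  assumes "bounded_inc x (bounds m n y cs) vs" and "\<forall>c\<in>set cs. 0 < c"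
  shows "comp_type (path_of m x cs vs) = cs"
  using assms
proof (induction cs arbitrary: x y vs)
  case Nil
  then show ?case using comp_type_replicate_East[of _ "[]"] by simp
next
  case (Cons c cs)
  obtain v ws where v: "vs = v # ws" "bounded_inc (Suc v) (bounds m n (y + c) cs) ws"
    using Cons.prems(1) by (rule bounded_inc_bounds_Cons)
  have "bounded_inc v (bounds m n (y + c) cs) ws"
    using v(2) by (rule bounded_inc_antimono) simp
  then show ?case
    using Cons hd_path_of[OF v(2)]
    by (simp add: v(1) comp_type_replicate_East comp_type_replicate_North)
qed

lemma path_of_above:
  assumes "0 < n" and "bounded_inc x (bounds m n y cs) vs" and "y + sum_list cs = n" and "x \<le> m"
  shows "above m n x y (path_of m x cs vs) \<and> count_list (path_of m x cs vs) East = m - x \<and>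
    count_list (path_of m x cs vs) North = sum_list cs"
  using assms
proof (induction cs arbitrary: x y vs)
  case Nil
  then show ?case
    using above_replicate_East[of m n x y "m - x" "[]"] by (simp add: count_list_replicate)
next
  case (Cons c cs)
  obtain v ws where v: "vs = v # ws" "x \<le> v" "v \<le> m * y div n"
    "bounded_inc (Suc v) (bounds m n (y + c) cs) ws"
    using Cons.prems(2) by (rule bounded_inc_bounds_Cons)
  have b: "bounded_inc v (bounds m n (y + c) cs) ws"
    using v(4) by (rule bounded_inc_antimono) simp
  have nv: "n * v \<le> m * y"
    using v(3) \<open>0 < n\<close> by (simp add: less_eq_div_iff_mult_less_eq mult.commute)
  \<comment> \<open>A block starts at height at most \<open>n\<close>, so its abscissa is at most
    \<open>m\<close> and the final run of east steps is not truncated.\<close>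
  also have "\<dots> \<le> m * n" using Cons.prems(3) by simp
  finally have "v \<le> m" using \<open>0 < n\<close> by (simp add: mult.commute)
  with Cons.IH[OF \<open>0 < n\<close> b] Cons.prems v nv show ?case
    by (simp add: above_replicate_East above_replicate_North count_list_replicate)
qed

lemma set_starts_path_of:
  assumes "bounded_inc x (bounds m n y cs) vs" and "\<forall>c\<in>set cs. 0 < c"
  shows "fst ` set (starts x y (path_of m x cs vs)) = set vs"
  using assms
proof (induction cs arbitrary: x y vs)
  case Nil
  then show ?case using starts_replicate_East[of x y _ "[]"] by simp
next
  case (Cons c cs)
  obtain v ws where v: "vs = v # ws" "x \<le> v" "bounded_inc (Suc v) (bounds m n (y + c) cs) ws"
    using Cons.prems(1) by (rule bounded_inc_bounds_Cons)
  have "bounded_inc v (bounds m n (y + c) cs) ws"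
    using v(3) by (rule bounded_inc_antimono) simp
  then show ?case
    using Cons v by (simp add: starts_replicate_East starts_replicate_North image_Un image_image
      image_constant_conv)
qed

text \<open>Only the first step of a block can be a return: each further north step raises the rank by
  \<open>m > n\<close>.\<close>

lemma num_returns_path_of:
  assumes "0 < n" and "n < m" and "bounded_inc x (bounds m n y cs) vs" and "\<forall>c\<in>set cs. 0 < c"
  shows "length (filter (\<lambda>p. rank m n p < int n) (starts x y (path_of m x cs vs))) =
    num_max (bounds m n y cs) vs"
  using assms
proof (induction cs arbitrary: x y vs)
  case Nil
  then show ?case using starts_replicate_East[of x y _ "[]"] by simp
next
  case (Cons c cs)
  obtain v ws where v: "vs = v # ws" "x \<le> v" "v \<le> m * y div n"
    "bounded_inc (Suc v) (bounds m n (y + c) cs) ws"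
    using Cons.prems(3) by (rule bounded_inc_bounds_Cons)
  have b: "bounded_inc v (bounds m n (y + c) cs) ws"
    using v(4) by (rule bounded_inc_antimono) simp
  have nv: "n * v \<le> m * y"
    using v(3) \<open>0 < n\<close> by (simp add: less_eq_div_iff_mult_less_eq mult.commute)
  have rank_iff: "rank m n (v, k) < int n \<longleftrightarrow> m * k < n * Suc v" for k
  proof -
    have "rank m n (v, k) < int n \<longleftrightarrow> int (m * k) < int (n * Suc v)"
      by (simp add: rank_def algebra_simps)
    then show ?thesis by (simp only: of_nat_less_iff)
  qed
  \<comment> \<open>The left side says that abscissa \<open>Suc v\<close> at height \<open>y\<close>
    lies beyond the line; as \<open>v\<close> is at most the floor, it then equals the
    floor.\<close>
  have first: "m * y < n * Suc v \<longleftrightarrow> v = m * y div n"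
    using v(3) \<open>0 < n\<close> div_less_iff_less_mult[of n "m * y" "Suc v"] by (auto simp: mult.commute)
  have rest: "\<not> m * k < n * Suc v" if "Suc y \<le> k" for k
  proof -
    have "n * Suc v \<le> m * y + m" using nv \<open>n < m\<close> by simp
    also have "\<dots> \<le> m * k" using mult_le_mono2[OF that, of m] by simp
    finally show ?thesis by simp
  qed
  have "[y..<y + c] = y # [Suc y..<y + c]" using Cons.prems(4) by (simp add: upt_conv_Cons)
  moreover have "filter (\<lambda>k. m * k < n * Suc v) [Suc y..<y + c] = []"
    using rest by (auto simp: filter_empty_conv)
  ultimately have "length (filter (\<lambda>k. m * k < n * Suc v) [y..<y + c]) =
      of_bool (v = m * y div n)"
    by (simp only: filter.simps first) simp
  then have "length (filter (\<lambda>p. rank m n p < int n) (map (Pair v) [y..<y + c])) =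
      of_bool (v = m * y div n)"
    by (simp only: filter_map length_map o_def rank_iff)
  then show ?case
    using Cons.IH[OF Cons.prems(1,2) b] Cons.prems(4) v
    by (simp add: starts_replicate_East starts_replicate_North)
qed

text \<open>Blocks are nonempty and \<open>m > n\<close>, so \<open>m * y\<close> grows by at least
  \<open>n\<close> from one block start to the next, and the quotient by at least one. This makes
  the symmetry of the counts applicable.\<close>

lemma bounds_strict:
  assumes "0 < n" and "n < m" and "\<forall>c\<in>set cs. 0 < c"
  shows "sorted_wrt (<) (bounds m n y cs) \<and> (\<forall>b\<in>set (bounds m n y cs). m * y div n \<le> b)"
  using assms(3)
proof (induction cs arbitrary: y)
  case (Cons c cs)
  have "m * y + n \<le> m * (y + c)" using assms(2) Cons.prems
    by (cases c) (auto simp: algebra_simps trans_le_add1 intro: less_imp_le)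
  then have "(m * y + n) div n \<le> m * (y + c) div n" by (rule div_le_mono)
  then have "m * y div n < m * (y + c) div n" using assms(1) by simp
  then show ?case using Cons.IH[of "y + c"] Cons.prems by fastforce
qed simp

section \<open>The involution\<close>

lemma Dyck_path_of:
  assumes "0 < n" and "n < m" and "\<forall>c\<in>set cs. 0 < c" and "sum_list cs = n"
    and "bounded_inc 0 (bounds m n 0 cs) vs"
  defines "P \<equiv> path_of m 0 cs vs"
  shows "P \<in> Dyck m n" and "comp_type P = cs" and "set (coarea P) = set vs"
    and "run n P = lead_min 0 vs" and "ret m n P = num_max (bounds m n 0 cs) vs"
proof -
  show "P \<in> Dyck m n"
    using path_of_above[OF assms(1,5)] assms by (simp add: Dyck_iff)
  show "comp_type P = cs" using comp_type_path_of assms(3,5) by (simp add: P_def)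
  show co: "set (coarea P) = set vs"
    using set_starts_path_of[OF assms(5,3)] by (simp add: coarea_def north_starts_eq P_def)
  show "ret m n P = num_max (bounds m n 0 cs) vs"
    using num_returns_path_of[OF assms(1,2,5,3)] by (simp add: ret_def north_starts_eq P_def)
  obtain c cs' where cs: "cs = c # cs'" using assms(1,4) by (cases cs) auto
  \<comment> \<open>The first block starts at height \<open>0\<close>, where the bound is
    \<open>0\<close>, so the first entry is \<open>0\<close>.\<close>
  then have "0 < lead_min 0 vs" using assms(5) by (auto simp: bounded_inc_Cons_iff)
  \<comment> \<open>There are at most \<open>n\<close> blocks, since their positive lengths sum to
    \<open>n\<close>.\<close>
  moreover have "length (bounds m n y cs) = length cs" for y by (induction cs arbitrary: y) auto
  then have "length vs \<le> n"
    using bounded_inc_length[OF assms(5)] assms(3,4)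
      sum_list_mono[of cs "\<lambda>_. 1" id] by (auto simp: Suc_le_eq sum_list_triv)
  ultimately show "run n P = lead_min 0 vs"
    using lead_min_eq_Min[OF assms(5)] co by (simp add: run_def)
qed

lemma fibre_bij:
  assumes "0 < n" and "n < m" and "\<forall>c\<in>set cs. 0 < c" and "sum_list cs = n"
  shows "bij_betw (path_of m 0 cs) (inc_set 0 (bounds m n 0 cs) r t)
    {P \<in> Dyck m n. comp_type P = cs \<and> run n P = r \<and> ret m n P = t}"
  unfolding bij_betw_def
proof (intro conjI)
  note props = Dyck_path_of[OF assms]
  show "inj_on (path_of m 0 cs) (inc_set 0 (bounds m n 0 cs) r t)"
  proof (rule inj_onI)
    fix vs ws
    assume "vs \<in> inc_set 0 (bounds m n 0 cs) r t" "ws \<in> inc_set 0 (bounds m n 0 cs) r t"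
      and eq: "path_of m 0 cs vs = path_of m 0 cs ws"
    then have b: "bounded_inc 0 (bounds m n 0 cs) vs" "bounded_inc 0 (bounds m n 0 cs) ws"
      by (auto simp: inc_set_def)
    \<comment> \<open>Both sets consist of the coarea values of the common path, and a strictly
      increasing list is determined by its set.\<close>
    have "set vs = set ws"
      using props(3)[OF b(1)] unfolding eq props(3)[OF b(2)] by (rule sym)
    with bounded_inc_sorted[OF b(1)] bounded_inc_sorted[OF b(2)] show "vs = ws"
      by (metis strict_sorted_equal)
  qed
  show "path_of m 0 cs ` inc_set 0 (bounds m n 0 cs) r t =
      {P \<in> Dyck m n. comp_type P = cs \<and> run n P = r \<and> ret m n P = t}"
  proof (intro equalityI subsetI)
    fix P
    assume "P \<in> path_of m 0 cs ` inc_set 0 (bounds m n 0 cs) r t"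
    then show "P \<in> {P \<in> Dyck m n. comp_type P = cs \<and> run n P = r \<and> ret m n P = t}"
      using props by (auto simp: inc_set_def)
  next
    fix P
    assume "P \<in> {P \<in> Dyck m n. comp_type P = cs \<and> run n P = r \<and> ret m n P = t}"
    then have P: "P \<in> Dyck m n" "comp_type P = cs" "run n P = r" "ret m n P = t" by auto
    obtain vs where vs: "P = path_of m 0 cs vs"
      "bounded_inc (if P = [] \<or> hd P = East then Suc 0 else 0) (bounds m n 0 cs) vs"
      using path_of_exists[OF assms(1), of 0 P m 0] P assms by (auto simp: Dyck_iff)
    have "bounded_inc 0 (bounds m n 0 cs) vs" using vs(2) by (rule bounded_inc_antimono) simp
    then show "P \<in> path_of m 0 cs ` inc_set 0 (bounds m n 0 cs) r t"
      using vs(1) P props[of vs] by (auto simp: inc_set_def)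
  qed
qed

text \<open>If some path has type \<open>cs\<close>, the parts of \<open>cs\<close> are positive
  with sum \<open>n\<close>, so both fibres are encoded by lists and equal counts give a bijection.
  Otherwise both fibres are empty.\<close>

lemma fibre_swap:
  assumes "0 < n" and "n < m"
  shows "\<exists>f. bij_betw f {P \<in> Dyck m n. comp_type P = cs \<and> run n P = r \<and> ret m n P = t}
    {P \<in> Dyck m n. comp_type P = cs \<and> run n P = t \<and> ret m n P = r}"
proof (cases "\<exists>P \<in> Dyck m n. comp_type P = cs")
  case True
  then have cs: "\<forall>c\<in>set cs. 0 < c" "sum_list cs = n"
    using assms comp_type_pos sum_list_comp_type by (auto simp: Dyck_iff)
  let ?B = "bounds m n 0 cs"
  have "card (inc_set 0 ?B r t) = card (inc_set 0 ?B t r)"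
    using bounds_strict[OF assms cs(1), of 0] by (intro card_inc_set_sym) auto
  from finite_same_card_bij[OF finite_inc_set finite_inc_set this]
  obtain h where "bij_betw h (inc_set 0 ?B r t) (inc_set 0 ?B t r)" ..
  with bij_betw_inv_into[OF fibre_bij[OF assms cs, of r t]]
  have "bij_betw (h \<circ> inv_into (inc_set 0 ?B r t) (path_of m 0 cs))
      {P \<in> Dyck m n. comp_type P = cs \<and> run n P = r \<and> ret m n P = t} (inc_set 0 ?B t r)"
    by (rule bij_betw_trans)
  then show ?thesis using fibre_bij[OF assms cs, of t r] by (intro exI) (rule bij_betw_trans)
next
  case False
  then have "{P \<in> Dyck m n. comp_type P = cs \<and> run n P = r \<and> ret m n P = t} = {}" for r t by auto
  then show ?thesis by (simp only: bij_betw_empty1) (simp add: bij_betw_def)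
qed

text \<open>Independently chosen fibre bijections need not be mutually inverse. So one is chosen for
  \<open>i < j\<close>, its inverse serves the opposite direction, and the identity serves the
  diagonal; the linear order decides the direction.\<close>

lemma involution_swapping:
  fixes c :: "'a \<Rightarrow> 'b" and f g :: "'a \<Rightarrow> 'k::linorder"
  assumes "\<And>k i j. \<exists>h. bij_betw h {x \<in> A. c x = k \<and> f x = i \<and> g x = j}
    {x \<in> A. c x = k \<and> f x = j \<and> g x = i}"
  shows "\<exists>\<Phi> \<in> A \<rightarrow> A. \<forall>x\<in>A. \<Phi> (\<Phi> x) = x \<and> c (\<Phi> x) = c x \<and> f (\<Phi> x) = g x \<and> g (\<Phi> x) = f x"
proof -
  define F where "F k i j = {x \<in> A. c x = k \<and> f x = i \<and> g x = j}" for k i j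
  define h where "h k i j = (SOME h. bij_betw h (F k i j) (F k j i))" for k i j
  have h: "bij_betw (h k i j) (F k i j) (F k j i)" for k i j
    unfolding h_def by (rule someI_ex[where P = "\<lambda>h. bij_betw h _ _"]) (unfold F_def, rule assms)
  define H where "H k i j = (if i < j then h k i j
    else if j < i then inv_into (F k j i) (h k j i) else id)" for k i j
  have HF: "H k i j x \<in> F k j i \<and> H k j i (H k i j x) = x" if "x \<in> F k i j" for k i j x
    using h[of k i j] h[of k j i] that
    by (auto simp: H_def bij_betw_def inv_into_into f_inv_into_f)
  define \<Phi> where "\<Phi> x = H (c x) (f x) (g x) x" for x
  have "\<Phi> x \<in> A \<and> \<Phi> (\<Phi> x) = x \<and> c (\<Phi> x) = c x \<and> f (\<Phi> x) = g x \<and> g (\<Phi> x) = f x" if "x \<in> A" for x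
  proof -
    have "\<Phi> x \<in> F (c x) (g x) (f x)" "H (c x) (g x) (f x) (\<Phi> x) = x"
      using HF[of x "c x" "f x" "g x"] that by (auto simp: \<Phi>_def F_def)
    then show ?thesis unfolding \<Phi>_def[of "\<Phi> x"] by (auto simp: F_def)
  qed
  then show ?thesis by (intro bexI[of _ \<Phi>]) auto
qed

theorem theorem3p1:
  fixes m n :: nat
  assumes "0 < n" and "n < m"
  shows "\<exists>\<Phi> \<in> Dyck m n \<rightarrow> Dyck m n. \<forall>P \<in> Dyck m n.
           \<Phi> (\<Phi> P) = P \<and>
           comp_type (\<Phi> P) = comp_type P \<and>
           run n (\<Phi> P) = ret m n P \<and>
           ret m n (\<Phi> P) = run n P"
  by (rule involution_swapping) (rule fibre_swap[OF assms])

end
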